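(* For every integer $k\ge 2$, the intersection graph of any (finite) set of unit caps of the unit sphere $S^k$ has dot product dimension at most $k+1$.
   Context: $S^k$ is the unit sphere in $\mathbb{R}^{k+1}$. A cap of $S^k$ with centre $\mathbf{c}\in S^k$ is a set $\{\mathbf{x}\in S^k \mid \mathbf{c}\cdot\mathbf{x}\ge a\}$, where $a\in(0,1]$ is a real number; its angular diameter is $2\arccos a$. A set of caps of $S^k$ is a set of unit caps if all caps in the set have the same angular diameter $\theta\in[0,\pi/2)$. The intersection graph of a collection of sets has the sets as vertices, two distinct ones being adjacent if and only if they intersect. A graph $G=(V,E)$ (finite, simple) has a $d$-dot product representation if there are vectors $\mathbf{a}^u\in\mathbb{R}^d$ ($u\in V$) and a threshold $t>0$ such that, for all distinct $u,v\in V$, $uv\in E$ if and only if $\mathbf{a}^u\cdot\mathbf{a}^v\ge t$. The dot product dimension of $G$ is the smallest $d\geq 1$ such that $G$ has a $d$-dot product representation. *)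

theory Defs
  imports Complex_Main "Jordan_Normal_Form.Matrix" "Graph_Theory.Pair_Digraph"
begin

text \<open>Vectors of \<open>\<real>\<^sup>d\<close> are the elements of \<^term>\<open>carrier_vec d :: real vec set\<close>, so that the
  dimension is an ordinary natural number; \<open>\<bullet>\<close> is the standard scalar product.\<close>

definition unit_sphere :: "nat \<Rightarrow> real vec set" where
  "unit_sphere k = {x \<in> carrier_vec (k + 1). sqrt (x \<bullet> x) = 1}"

definition cap :: "nat \<Rightarrow> real vec \<Rightarrow> real \<Rightarrow> real vec set" where
  "cap k c a = {x \<in> unit_sphere k. c \<bullet> x \<ge> a}"

text \<open>The angular diameter is stated as a relation, since a cap is a bare set that does not carry
  its centre and its bound \<open>a\<close>. For \<open>k \<ge> 1\<close> the set determines \<open>a\<close>, so the relation is functional.\<close>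

definition cap_of_angular_diameter :: "nat \<Rightarrow> real \<Rightarrow> real vec set \<Rightarrow> bool" where
  "cap_of_angular_diameter k \<theta> C \<longleftrightarrow>
     (\<exists>c \<in> unit_sphere k. \<exists>a. 0 < a \<and> a \<le> 1 \<and> C = cap k c a \<and> \<theta> = 2 * arccos a)"

definition set_of_unit_caps :: "nat \<Rightarrow> real vec set set \<Rightarrow> bool" where
  "set_of_unit_caps k F \<longleftrightarrow>
     (\<exists>\<theta>. 0 \<le> \<theta> \<and> \<theta> < pi / 2 \<and> (\<forall>C \<in> F. cap_of_angular_diameter k \<theta> C))"

text \<open>A finite simple graph is a \<^locale>\<open>pair_graph\<close>: the edge \<open>uv\<close> is the pair of opposite arcs
  \<open>(u, v)\<close> and \<open>(v, u)\<close>, and there are no loops.\<close>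

definition intersection_graph :: "'a set set \<Rightarrow> 'a set pair_pre_digraph" where
  "intersection_graph F =
     \<lparr>pverts = F, parcs = {(A, B). A \<in> F \<and> B \<in> F \<and> A \<noteq> B \<and> A \<inter> B \<noteq> {}}\<rparr>"

definition has_dot_product_representation :: "nat \<Rightarrow> 'a pair_pre_digraph \<Rightarrow> bool" where
  "has_dot_product_representation d G \<longleftrightarrow>
     (\<exists>(a :: 'a \<Rightarrow> real vec) t. t > 0 \<and> (\<forall>u \<in> pverts G. a u \<in> carrier_vec d) \<and>
       (\<forall>u \<in> pverts G. \<forall>v \<in> pverts G. u \<noteq> v \<longrightarrow> ((u, v) \<in> parcs G \<longleftrightarrow> a u \<bullet> a v \<ge> t)))"

definition dot_product_dimension :: "'a pair_pre_digraph \<Rightarrow> nat" where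
  "dot_product_dimension G = (LEAST d. d \<ge> 1 \<and> has_dot_product_representation d G)"

lemma pair_graph_intersection_graph:
  assumes "finite F"
  shows "pair_graph (intersection_graph F)"
proof -
  have "finite (parcs (intersection_graph F))"
    by (rule finite_subset[of _ "F \<times> F"]) (use assms in \<open>auto simp: intersection_graph_def\<close>)
  moreover have "sym (parcs (intersection_graph F))"
    by (auto simp: intersection_graph_def sym_def)
  ultimately show ?thesis
    using assms by unfold_locales
      (auto simp: intersection_graph_def symmetric_def arcs_ends_def arc_to_ends_def)
qed

text \<open>The minimum defining the dot product dimension of a finite simple graph is attained:
  the rows of the incidence matrix, with threshold 1, form a representation.\<close>

lemma ex_dot_product_representation:
  assumes "pair_graph G"
  shows "\<exists>d \<ge> 1. has_dot_product_representation d G"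
proof -
  interpret pair_graph G by (rule assms)
  have sym: "(v, u) \<in> parcs G" if "(u, v) \<in> parcs G" for u v
    using that pair_sym_arcs by (auto simp: symmetric_def sym_def arcs_ends_def arc_to_ends_def)
  define m where "m = card (parcs G)"
  obtain f where f: "bij_betw f {0..<m} (parcs G)"
    using ex_bij_betw_nat_finite[OF pair_finite_arcs] unfolding m_def by blast
  define I where "I = (\<lambda>u i. i < m \<and> (u = fst (f i) \<or> u = snd (f i)))"
  define a :: "'a \<Rightarrow> real vec" where "a = (\<lambda>u. vec (m + 1) (\<lambda>i. of_bool (I u i)))"
  have "(u, v) \<in> parcs G \<longleftrightarrow> a u \<bullet> a v \<ge> 1" if "u \<noteq> v" for u v
  proof -
    have "a u \<bullet> a v = (\<Sum>i = 0..<m + 1. of_bool (I u i \<and> I v i))"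
      by (simp add: a_def scalar_prod_def flip: of_bool_conj)
    also have "\<dots> = real (card {i \<in> {0..<m + 1}. I u i \<and> I v i})"
      by (subst sum_of_bool_eq) (simp_all only: Int_def finite_atLeastLessThan mem_Collect_eq)
    finally have "a u \<bullet> a v \<ge> 1 \<longleftrightarrow> card {i \<in> {0..<m + 1}. I u i \<and> I v i} > 0"
      by linarith
    also have "\<dots> \<longleftrightarrow> (\<exists>i < m. I u i \<and> I v i)"
      by (auto simp: card_gt_0_iff I_def)
    also have "\<dots> \<longleftrightarrow> (\<exists>i < m. f i = (u, v) \<or> f i = (v, u))"
      using that by (auto simp: I_def prod_eq_iff)
    also have "\<dots> \<longleftrightarrow> (u, v) \<in> parcs G \<or> (v, u) \<in> parcs G"
      using f by (force simp: bij_betw_def image_iff)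
    finally show ?thesis
      using sym by blast
  qed
  then have "has_dot_product_representation (m + 1) G"
    unfolding has_dot_product_representation_def
    by (intro exI[of _ a] exI[of _ 1]) (auto simp: a_def)
  then show ?thesis
    by (intro exI[of _ "m + 1"]) simp
qed

lemma dot_product_dimension_attained:
  assumes "pair_graph G"
  shows "dot_product_dimension G \<ge> 1"
    and "has_dot_product_representation (dot_product_dimension G) G"
  using LeastI_ex[OF ex_dot_product_representation[OF assms]]
  by (simp_all add: dot_product_dimension_def)

end

theory Submission
  imports Defs
begin

text \<open>Let \<open>a = cos (\<theta> / 2)\<close>. Two caps with bound \<open>a\<close> and centres \<open>c\<close>, \<open>d\<close> intersect iff the
  normalised midpoint of the centres lies in both, that is, iff \<open>c \<bullet> d \<ge> 2 * a\<^sup>2 - 1 = cos \<theta>\<close>.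
  As \<open>\<theta> < pi / 2\<close>, this threshold is positive, so the centres themselves form a dot product
  representation.\<close>

text \<open>Removing from \<open>s\<close> its component along the unit vector \<open>x\<close>
  leaves \<open>r\<close>, whose squared length is nonnegative and expands to the difference of the
  two sides.\<close>

lemma cauchy_schwarz_unit_vec:
  fixes s x :: "real vec"
  assumes s: "s \<in> carrier_vec n" and x: "x \<in> carrier_vec n" and unit: "x \<bullet> x = 1"
  shows "(s \<bullet> x)\<^sup>2 \<le> s \<bullet> s"
proof -
  define r where "r = s - (s \<bullet> x) \<cdot>\<^sub>v x"
  have "0 \<le> r \<bullet> r"
    by (simp add: scalar_prod_def sum_nonneg)
  also have "r \<bullet> r = s \<bullet> s - (s \<bullet> x)\<^sup>2"
    using s x unit comm_scalar_prod[OF x s]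
    by (simp add: r_def minus_scalar_prod_distrib[of _ n] scalar_prod_minus_distrib[of _ n]
        power2_eq_square)
  finally show ?thesis
    by simp
qed

lemma scalar_prod_add_self:
  fixes c d :: "real vec"
  assumes "c \<in> carrier_vec n" and "d \<in> carrier_vec n"
  shows "(c + d) \<bullet> (c + d) = c \<bullet> c + 2 * (c \<bullet> d) + d \<bullet> d"
  using assms comm_scalar_prod[OF assms]
  by (simp add: add_scalar_prod_distrib[of _ n] scalar_prod_add_distrib[of _ n])

lemma mem_unit_sphere_iff:
  "x \<in> unit_sphere k \<longleftrightarrow> x \<in> carrier_vec (k + 1) \<and> x \<bullet> x = 1"
  by (simp add: unit_sphere_def)

text \<open>Both directions go through \<open>s = c + d\<close>: its squared length is
  \<open>2 + 2 * (c \<bullet> d)\<close>, so the condition on the right says that \<open>s\<close>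
  has length at least \<open>2 * a\<close>.\<close>

lemma caps_intersect_iff:
  assumes c: "c \<in> unit_sphere k" and d: "d \<in> unit_sphere k" and a: "0 < a"
  shows "cap k c a \<inter> cap k d a \<noteq> {} \<longleftrightarrow> c \<bullet> d \<ge> 2 * a\<^sup>2 - 1"
proof -
  have cc: "c \<in> carrier_vec (k + 1)" "c \<bullet> c = 1" and dc: "d \<in> carrier_vec (k + 1)" "d \<bullet> d = 1"
    using c d by (simp_all add: mem_unit_sphere_iff)
  define s where "s = c + d"
  have s: "s \<in> carrier_vec (k + 1)"
    using cc dc by (simp add: s_def)
  have ss: "s \<bullet> s = 2 + 2 * (c \<bullet> d)"
    using scalar_prod_add_self[OF cc(1) dc(1)] cc dc by (simp add: s_def)
  show ?thesis
  proof
    assume "cap k c a \<inter> cap k d a \<noteq> {}"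
    then obtain x where x: "x \<in> carrier_vec (k + 1)" "x \<bullet> x = 1" "c \<bullet> x \<ge> a" "d \<bullet> x \<ge> a"
      by (auto simp: cap_def mem_unit_sphere_iff)
    \<comment> \<open>Adding the two cap inequalities for \<open>x\<close> gives one bound on
      \<open>s\<close>, to which Cauchy-Schwarz applies.\<close>
    have "2 * a \<le> s \<bullet> x"
      using x cc dc by (simp add: s_def add_scalar_prod_distrib[of _ "k + 1"])
    then have "(2 * a)\<^sup>2 \<le> (s \<bullet> x)\<^sup>2"
      using a by (intro power_mono) auto
    also have "\<dots> \<le> s \<bullet> s"
      using s x by (intro cauchy_schwarz_unit_vec)
    finally show "c \<bullet> d \<ge> 2 * a\<^sup>2 - 1"
      by (simp add: ss power_mult_distrib)
  next
    assume "c \<bullet> d \<ge> 2 * a\<^sup>2 - 1"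
    then have ge: "(2 * a)\<^sup>2 \<le> s \<bullet> s"
      by (simp add: ss power_mult_distrib)
    \<comment> \<open>The length of \<open>s\<close>. Since \<open>2 * a \<le> l\<close> and
      \<open>a\<close> is positive, the centres are not antipodal and \<open>s\<close> can be
      normalised.\<close>
    define l where "l = sqrt (s \<bullet> s)"
    have l: "2 * a \<le> l"
      unfolding l_def by (rule real_le_rsqrt[OF ge])
    have l2: "l * l = s \<bullet> s"
      using order_trans[OF zero_le_power2 ge] by (simp add: l_def)
    have l0: "l > 0"
      using l a by linarith
    define x where "x = (1 / l) \<cdot>\<^sub>v s"
    have "x \<in> unit_sphere k"
      using s l0 by (simp add: mem_unit_sphere_iff x_def flip: l2)
    \<comment> \<open>By symmetry both products equal \<open>1 + c \<bullet> d\<close>, which is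
      half of \<open>s \<bullet> s\<close>; dividing by \<open>l\<close> leaves
      \<open>l / 2\<close>, at least \<open>a\<close>.\<close>
    moreover have "c \<bullet> s = l * l / 2" "d \<bullet> s = l * l / 2"
      using cc dc comm_scalar_prod[OF cc(1) dc(1)]
      by (simp_all add: l2 ss, simp_all add: s_def scalar_prod_add_distrib[of _ "k + 1"])
    then have "c \<bullet> x = l / 2" "d \<bullet> x = l / 2"
      using cc dc s l0 by (simp_all add: x_def)
    ultimately have "x \<in> cap k c a \<inter> cap k d a"
      using l by (simp add: cap_def)
    then show "cap k c a \<inter> cap k d a \<noteq> {}"
      by blast
  qed
qed

lemma has_dot_product_representation_unit_caps:
  assumes "set_of_unit_caps k F"
  shows "has_dot_product_representation (k + 1) (intersection_graph F)"
proof -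
  obtain \<theta> where \<theta>: "0 \<le> \<theta>" "\<theta> < pi / 2"
    and F: "\<forall>C \<in> F. cap_of_angular_diameter k \<theta> C"
    using assms by (auto simp: set_of_unit_caps_def)
  define a where "a = cos (\<theta> / 2)"
  have a: "0 < a"
    using \<theta> by (auto simp: a_def intro!: cos_gt_zero_pi)
  have cos: "2 * a\<^sup>2 - 1 = cos \<theta>"
    using cos_double_cos[of "\<theta> / 2"] by (simp add: a_def)
  \<comment> \<open>The angular diameter fixes the bound: \<theta> is twice the arccosine of a cap's
    bound, so that bound is \<open>cos (\<theta> / 2)\<close>. Hence all caps share \<open>a\<close>
    and differ only in their centres.\<close>
  have "\<forall>C \<in> F. \<exists>c. c \<in> unit_sphere k \<and> C = cap k c a"
    using F by (force simp: cap_of_angular_diameter_def a_def)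
  then obtain c where c: "\<And>C. C \<in> F \<Longrightarrow> c C \<in> unit_sphere k" "\<And>C. C \<in> F \<Longrightarrow> C = cap k (c C) a"
    by metis
  have adj: "C \<inter> D \<noteq> {} \<longleftrightarrow> c C \<bullet> c D \<ge> cos \<theta>" if "C \<in> F" "D \<in> F" for C D
    using caps_intersect_iff[OF c(1)[OF that(1)] c(1)[OF that(2)] a] c(2)[OF that(1)] c(2)[OF that(2)]
    by (simp add: cos)
  have "cos \<theta> > 0"
    using \<theta> by (intro cos_gt_zero_pi) auto
  then show ?thesis
    unfolding has_dot_product_representation_def
    using c(1) adj
    by (intro exI[of _ c] exI[of _ "cos \<theta>"]) (auto simp: intersection_graph_def mem_unit_sphere_iff)
qed

theorem theorem10:
  fixes k :: nat and F :: "real vec set set"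
  assumes "k \<ge> 2"
    and "finite F"
    and "set_of_unit_caps k F"
  shows "dot_product_dimension (intersection_graph F) \<le> k + 1"
  unfolding dot_product_dimension_def
  using has_dot_product_representation_unit_caps[OF assms(3)]
  by (intro Least_le) simp

end
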